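(* If a signed graph $(G,\sigma)$ admits a homomorphism to a signed graph $(H,\pi)$, then $g_{ij}(G,\sigma)\geq g_{ij}(H,\pi)$ for each $ij\in\mathbb{Z}_2^2$.
   Context: Graphs may have loops and multiple edges; each edge has a multiset of two endpoints. A signed graph $(G,\sigma)$ is a graph with a map $\sigma:E(G)\to\{+,-\}$. A walk is a sequence $v_0e_1v_1\cdots e_kv_k$ where $e_i$ has endpoints $v_{i-1},v_i$; its length is $k$; it is closed if $v_0=v_k$, and nontrivial if $k\ge1$. The sign of a walk is the product of the signs of its edges, counted with repetition. A homomorphism $(G,\sigma)\to(H,\pi)$ is a mapping of vertices of $G$ to vertices of $H$ and edges of $G$ to edges of $H$ that preserves incidence (an edge with endpoints $u,v$ goes to an edge whose endpoints are the images of $u,v$) and preserves the signs of closed walks. A closed walk has type $00$ if it is positive of even length, $10$ if negative of even length, $01$ if positive of odd length, and $11$ if negative of odd length. The walk-girth $g_{ij}(G,\sigma)$ is the length of a shortest nontrivial closed walk of type $ij$ in $(G,\sigma)$, and $g_{ij}(G,\sigma)=\infty$ if there is none. *)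

theory Defs
  imports "HOL-Library.Multiset" "HOL-Library.Extended_Nat" "HOL-Library.Z2"
begin

text \<open>Undirected graphs, possibly infinite, with loops (\<open>ends e = {#v, v#}\<close>) and multiple edges.\<close>

record ('v, 'e) mgraph =
  verts :: "'v set"
  edges :: "'e set"
  ends :: "'e \<Rightarrow> 'v multiset"

definition mgraph :: "('v, 'e) mgraph \<Rightarrow> bool" where
  "mgraph G \<longleftrightarrow> (\<forall>e\<in>edges G. size (ends G e) = 2 \<and> set_mset (ends G e) \<subseteq> verts G)"

text \<open>The signs \<open>+\<close> and \<open>-\<close> are the integers \<open>1\<close> and \<open>-1\<close>, so that products of signs are
  ordinary products.\<close>

definition signed_graph :: "('v, 'e) mgraph \<Rightarrow> ('e \<Rightarrow> int) \<Rightarrow> bool" where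
  "signed_graph G \<sigma> \<longleftrightarrow> mgraph G \<and> (\<forall>e\<in>edges G. \<sigma> e \<in> {1, -1})"

text \<open>The walk \<open>v\<^sub>0 e\<^sub>1 v\<^sub>1 \<dots> e\<^sub>k v\<^sub>k\<close> is given by the list \<open>vs = [v\<^sub>0, \<dots>, v\<^sub>k]\<close> of its vertices and the
  list \<open>es = [e\<^sub>1, \<dots>, e\<^sub>k]\<close> of its edges; its length \<open>k\<close> is \<open>length es\<close>.\<close>

definition walk :: "('v, 'e) mgraph \<Rightarrow> 'v list \<Rightarrow> 'e list \<Rightarrow> bool" where
  "walk G vs es \<longleftrightarrow>
     length vs = Suc (length es) \<and> set vs \<subseteq> verts G \<and> set es \<subseteq> edges G \<and>
     (\<forall>i<length es. ends G (es ! i) = {#vs ! i, vs ! Suc i#})"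

definition closed_walk :: "('v, 'e) mgraph \<Rightarrow> 'v list \<Rightarrow> 'e list \<Rightarrow> bool" where
  "closed_walk G vs es \<longleftrightarrow> walk G vs es \<and> hd vs = last vs"

definition walk_sign :: "('e \<Rightarrow> int) \<Rightarrow> 'e list \<Rightarrow> int" where
  "walk_sign \<sigma> es = prod_list (map \<sigma> es)"

text \<open>A homomorphism consists of a vertex map \<open>f\<close> and an edge map \<open>h\<close>.\<close>

definition sg_hom ::
  "('v, 'e) mgraph \<Rightarrow> ('e \<Rightarrow> int) \<Rightarrow> ('w, 'd) mgraph \<Rightarrow> ('d \<Rightarrow> int) \<Rightarrow>
   ('v \<Rightarrow> 'w) \<Rightarrow> ('e \<Rightarrow> 'd) \<Rightarrow> bool" where
  "sg_hom G \<sigma> H \<pi> f h \<longleftrightarrow>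
     (\<forall>v\<in>verts G. f v \<in> verts H) \<and>
     (\<forall>e\<in>edges G. h e \<in> edges H) \<and>
     (\<forall>e\<in>edges G. ends H (h e) = image_mset f (ends G e)) \<and>
     (\<forall>vs es. closed_walk G vs es \<longrightarrow> walk_sign \<pi> (map h es) = walk_sign \<sigma> es)"

text \<open>In the type \<open>ij\<close> of a closed walk, \<open>i\<close> records the sign and \<open>j\<close> the parity of the length.\<close>

definition walk_type :: "('e \<Rightarrow> int) \<Rightarrow> 'e list \<Rightarrow> bit \<times> bit" where
  "walk_type \<sigma> es =
     (if walk_sign \<sigma> es = 1 then 0 else 1, if even (length es) then 0 else 1)"

text \<open>The infimum in \<^typ>\<open>enat\<close> is attained if the set is nonempty, and is \<open>\<infinity>\<close> otherwise.\<close>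

definition walk_girth :: "bit \<times> bit \<Rightarrow> ('v, 'e) mgraph \<Rightarrow> ('e \<Rightarrow> int) \<Rightarrow> enat" where
  "walk_girth ij G \<sigma> =
     Inf {enat (length es) | vs es.
            closed_walk G vs es \<and> length es \<ge> 1 \<and> walk_type \<sigma> es = ij}"

end

theory Submission
  imports Defs
begin

text \<open>A homomorphism carries every closed walk of the source to a closed walk of the target.
  Incidence makes the image a walk, the edge count and so the parity of the length are those of the
  original, and the sign is preserved by the definition of a homomorphism. Hence every length of a
  nontrivial closed walk of a given type in the source also occurs in the target, and an infimum
  over a larger set of lengths is no larger. This settles the infinite case as well, since the
  infimum of the empty set is \<open>\<infinity>\<close>.\<close>

lemma sg_hom_walk:
  assumes "sg_hom G \<sigma> H \<pi> f h" and "walk G vs es"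
  shows "walk H (map f vs) (map h es)"
proof -
  have "ends H (map h es ! i) = {#map f vs ! i, map f vs ! Suc i#}" if "i < length es" for i
  proof -
    have "es ! i \<in> edges G"
      using assms(2) that by (auto simp: walk_def)
    with assms that show ?thesis
      by (simp add: sg_hom_def walk_def)
  qed
  with assms show ?thesis
    by (auto simp: sg_hom_def walk_def)
qed

lemma sg_hom_closed_walk:
  assumes "sg_hom G \<sigma> H \<pi> f h" and "closed_walk G vs es"
  shows "closed_walk H (map f vs) (map h es)"
proof -
  have "vs \<noteq> []"
    using assms(2) by (auto simp: closed_walk_def walk_def)
  with assms show ?thesis
    by (simp add: closed_walk_def sg_hom_walk hd_map last_map)
qed

lemma sg_hom_walk_type:
  assumes "sg_hom G \<sigma> H \<pi> f h" and "closed_walk G vs es"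
  shows "walk_type \<pi> (map h es) = walk_type \<sigma> es"
  using assms by (simp add: sg_hom_def walk_type_def)

lemma sg_hom_walk_girth_le:
  assumes "sg_hom G \<sigma> H \<pi> f h"
  shows "walk_girth ij H \<pi> \<le> walk_girth ij G \<sigma>"
  unfolding walk_girth_def
proof (rule Inf_superset_mono, clarify)
  fix vs es
  assume "closed_walk G vs es" and "1 \<le> length es" and "ij = walk_type \<sigma> es"
  with assms show "\<exists>vs' es'. enat (length es) = enat (length es') \<and>
      closed_walk H vs' es' \<and> 1 \<le> length es' \<and> walk_type \<pi> es' = walk_type \<sigma> es"
    by (intro exI[of _ "map f vs"] exI[of _ "map h es"])
      (simp add: sg_hom_closed_walk sg_hom_walk_type)
qed

theorem lemma17:
  fixes G :: "('v, 'e) mgraph" and \<sigma> :: "'e \<Rightarrow> int"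
    and H :: "('w, 'd) mgraph" and \<pi> :: "'d \<Rightarrow> int"
  assumes "signed_graph G \<sigma>" and "signed_graph H \<pi>"
    and "\<exists>f h. sg_hom G \<sigma> H \<pi> f h"
  shows "\<forall>ij :: bit \<times> bit. walk_girth ij G \<sigma> \<ge> walk_girth ij H \<pi>"
  using assms(3) by (blast intro: sg_hom_walk_girth_le)

end
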